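(* Let $m,n\geq1$ and let $\sigma\in\mathcal{M}ax_n^{(m)}$. Then the successors of $\sigma$ in the metasylvester lattice are exactly the $m$-permutations $\mu=\mathrm{MaxClass}(\sigma')$ where $\sigma'$ is a successor of $\sigma$ in the $m$-permutations lattice. Equivalently, they are exactly the $m$-permutations $\mu$ for which there exist letters $a<b$ and words $u,v,w$ such that $$\sigma=u\,a_1\,v\,a_m\,b\,w\qquad\text{and}\qquad \mu=u\,b\,a_1\,v\,a_m\,w,$$ where $a_1$ and $a_m$ are the first and the last occurrence of the letter $a$ in $\sigma$, and $b$ is some occurrence of the letter $b$ (for $m=1$, the factor $a_1\,v\,a_m$ is the single letter $a$).
   Context: An $m$-permutation of size $n$ is a rearrangement of the word $1^m2^m\cdots n^m$; their set is $\mathfrak{S}_n^{(m)}$. For a letter $b$, $b_i$ denotes the $i$-th occurrence of $b$ from the left. A co-inversion of $\sigma\in\mathfrak{S}_n^{(m)}$ is a pair $(a_i,b_j)$ with $1\leq a<b\leq n$, $1\le i,j\le m$, such that $b_j$ appears before $a_i$ in $\sigma$; $\mathrm{coinv}(\sigma)$ is the set of co-inversions, and $\sigma\leq\mu$ means $\mathrm{coinv}(\sigma)\subseteq\mathrm{coinv}(\mu)$ (the $m$-permutations lattice). The metasylvester congruence $\equiv$ on $\mathfrak{S}_n^{(m)}$ is the equivalence relation generated by $u\,ac\,v\,a\,w\equiv u\,ca\,v\,a\,w$ for letters $a<c$ and words $u,v,w$, and $u\,b\,v\,ac\,w\,b\,x\equiv u\,b\,v\,ca\,w\,b\,x$ for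 letters $a<b<c$ and words $u,v,w,x$. Each class contains a unique maximal element for $\leq$, which is the only element of the class containing no subword (not necessarily consecutive) $a\cdots b\cdots a$ with $a<b$; the maximal element of the class of $\sigma$ is $\mathrm{MaxClass}(\sigma)$, and $\mathcal{M}ax_n^{(m)}$ is the set of all these maximal elements. The metasylvester lattice is $\mathcal{M}ax_n^{(m)}$ with the order induced from $\mathfrak{S}_n^{(m)}$. A successor of an element $x$ in a poset is an element $y$ covering $x$, i.e. $x<y$ with no $z$ such that $x<z<y$. *)

theory Defs
  imports "HOL-Combinatorics.Multiset_Permutations"
begin

definition mperms :: "nat \<Rightarrow> nat \<Rightarrow> nat list set" where
  "mperms m n = permutations_of_multiset (\<Sum>b\<in>{1..n}. replicate_mset m b)"

text \<open>The pair \<open>(b, i)\<close> stands for the occurrence \<open>b\<^sub>i\<close>; positions \<open>p\<close> start at 0,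
  the index \<open>i\<close> of an occurrence starts at 1.\<close>

definition occurrence :: "nat list \<Rightarrow> nat \<Rightarrow> nat \<times> nat" where
  "occurrence \<sigma> p = (\<sigma> ! p, count_list (take (Suc p) \<sigma>) (\<sigma> ! p))"

text \<open>The smaller letter is the first component of a co-inversion, although it comes later
  in the word. For an \<open>m\<close>-permutation of size \<open>n\<close> the bounds \<open>1 \<le> a < b \<le> n\<close> and
  \<open>1 \<le> i, j \<le> m\<close> hold automatically.\<close>

definition coinv :: "nat list \<Rightarrow> ((nat \<times> nat) \<times> (nat \<times> nat)) set" where
  "coinv \<sigma> = {((a, i), (b, j)) | a i b j. a < b \<and>
     (\<exists>q p. q < p \<and> p < length \<sigma> \<and> occurrence \<sigma> q = (b, j) \<and> occurrence \<sigma> p = (a, i))}"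

definition mperm_le :: "nat list \<Rightarrow> nat list \<Rightarrow> bool" where
  "mperm_le \<sigma> \<mu> \<longleftrightarrow> coinv \<sigma> \<subseteq> coinv \<mu>"

definition mperm_less :: "nat list \<Rightarrow> nat list \<Rightarrow> bool" where
  "mperm_less \<sigma> \<mu> \<longleftrightarrow> mperm_le \<sigma> \<mu> \<and> \<sigma> \<noteq> \<mu>"

text \<open>Successors (upper covers) of \<open>x\<close> in the set \<open>P\<close> with the induced order.\<close>

definition successors :: "nat list set \<Rightarrow> nat list \<Rightarrow> nat list set" where
  "successors P x =
     {y \<in> P. mperm_less x y \<and> \<not> (\<exists>z\<in>P. mperm_less x z \<and> mperm_less z y)}"

inductive metasylvester_step :: "nat list \<Rightarrow> nat list \<Rightarrow> bool" where
  "a < c \<Longrightarrow>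
     metasylvester_step (u @ [a, c] @ v @ [a] @ w) (u @ [c, a] @ v @ [a] @ w)"
| "a < b \<Longrightarrow> b < c \<Longrightarrow>
     metasylvester_step (u @ [b] @ v @ [a, c] @ w @ [b] @ x) (u @ [b] @ v @ [c, a] @ w @ [b] @ x)"

definition metasylvester_cong :: "nat \<Rightarrow> nat \<Rightarrow> nat list \<Rightarrow> nat list \<Rightarrow> bool" where
  "metasylvester_cong m n =
     equivclp (\<lambda>\<sigma> \<tau>. \<sigma> \<in> mperms m n \<and> \<tau> \<in> mperms m n \<and> metasylvester_step \<sigma> \<tau>)"

definition metasylvester_class :: "nat \<Rightarrow> nat \<Rightarrow> nat list \<Rightarrow> nat list set" where
  "metasylvester_class m n \<sigma> = {\<tau> \<in> mperms m n. metasylvester_cong m n \<sigma> \<tau>}"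

definition maximal_in_class :: "nat \<Rightarrow> nat \<Rightarrow> nat list \<Rightarrow> nat list \<Rightarrow> bool" where
  "maximal_in_class m n \<sigma> \<tau> \<longleftrightarrow> \<tau> \<in> metasylvester_class m n \<sigma> \<and>
     \<not> (\<exists>\<rho>\<in>metasylvester_class m n \<sigma>. mperm_less \<tau> \<rho>)"

definition MaxClass :: "nat \<Rightarrow> nat \<Rightarrow> nat list \<Rightarrow> nat list" where
  "MaxClass m n \<sigma> = (THE \<tau>. maximal_in_class m n \<sigma> \<tau>)"

definition Max_mperms :: "nat \<Rightarrow> nat \<Rightarrow> nat list set" where
  "Max_mperms m n = {\<tau>. \<exists>\<sigma>\<in>mperms m n. maximal_in_class m n \<sigma> \<tau>}"

end

theory Submission
  imports Defs
begin

text \<open>If \<open>\<sigma> < \<tau>\<close>, then some ascent \<open>ab\<close> of \<open>\<sigma>\<close> is a co-inversion of \<open>\<tau>\<close>, so the covers of the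
  \<open>m\<close>-permutations lattice are the exchanges of ascents. If moreover \<open>\<sigma>\<close> avoids the pattern
  \<open>a\<cdots>b\<cdots>a\<close> with \<open>a < b\<close>, then the \<open>a\<close> of such an ascent is the last one, all letters between the
  first and the last \<open>a\<close> are at most \<open>a\<close>, and in a pattern-avoiding \<open>\<tau> \<ge> \<sigma>\<close> where \<open>b\<close> precedes the
  last \<open>a\<close> it must precede that whole block. Moving \<open>b\<close> from the exchanged ascent to the front of
  the block takes only metasylvester steps and gives a word that again avoids the pattern.

  Each step enlarges the set of co-inversions, and a word admitting no step avoids the pattern.
  Pattern-avoiding words are unique in their class: the transitive closure of the relation
  ``\<open>c\<^sub>j\<close> precedes some \<open>a\<close>'' (\<open>a < c\<close>) is invariant under the steps, and for pattern-avoiding words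
  this relation is already transitive and determines the co-inversions.\<close>

section \<open>Order of entries in a list\<close>

text \<open>The recursion yields \<open>precedes_append\<close> as a rewrite rule, so the order
  within an explicit concatenation is computed by simplification. On a list of distinct entries this
  is a strict linear order.\<close>

primrec precedes :: "'a list \<Rightarrow> 'a \<Rightarrow> 'a \<Rightarrow> bool" where
  "precedes [] x y \<longleftrightarrow> False"
| "precedes (z # zs) x y \<longleftrightarrow> z = x \<and> y \<in> set zs \<or> precedes zs x y"

lemma precedes_append [simp]:
  "precedes (xs @ ys) x y \<longleftrightarrow>
     precedes xs x y \<or> precedes ys x y \<or> x \<in> set xs \<and> y \<in> set ys"
  by (induction xs) auto

lemma precedes_in_set: "precedes xs x y \<Longrightarrow> x \<in> set xs \<and> y \<in> set xs"
  by (induction xs) auto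

lemma precedes_conv_nth:
  "precedes xs x y \<longleftrightarrow> (\<exists>i j. i < j \<and> j < length xs \<and> xs ! i = x \<and> xs ! j = y)"
proof (induction xs)
  case (Cons z zs)
  have "(\<exists>i j. i < j \<and> j < length (z # zs) \<and> (z # zs) ! i = x \<and> (z # zs) ! j = y) \<longleftrightarrow>
      z = x \<and> y \<in> set zs \<or> (\<exists>i j. i < j \<and> j < length zs \<and> zs ! i = x \<and> zs ! j = y)"
    (is "?L \<longleftrightarrow> ?R")
  proof
    assume ?L
    then obtain i j where ij: "i < j" "j < length (z # zs)" "(z # zs) ! i = x" "(z # zs) ! j = y"
      by blast
    then obtain j' where "j = Suc j'" by (cases j) auto
    with ij show ?R by (cases i) auto
  next
    assume ?R
    then show ?L
    proof
      assume "z = x \<and> y \<in> set zs"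
      then obtain j where "j < length zs" "zs ! j = y" "z = x" by (auto simp: in_set_conv_nth)
      then show ?L by (intro exI[of _ 0] exI[of _ "Suc j"]) auto
    next
      assume "\<exists>i j. i < j \<and> j < length zs \<and> zs ! i = x \<and> zs ! j = y"
      then obtain i j where "i < j" "j < length zs" "zs ! i = x" "zs ! j = y" by blast
      then show ?L by (intro exI[of _ "Suc i"] exI[of _ "Suc j"]) auto
    qed
  qed
  with Cons.IH show ?case by simp
qed auto

lemma precedes_total:
  "x \<in> set xs \<Longrightarrow> y \<in> set xs \<Longrightarrow> x \<noteq> y \<Longrightarrow> precedes xs x y \<or> precedes xs y x"
  by (induction xs) auto

lemma precedes_trans:
  "distinct xs \<Longrightarrow> precedes xs x y \<Longrightarrow> precedes xs y z \<Longrightarrow> precedes xs x z"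
  by (induction xs) (auto dest: precedes_in_set)

lemma precedes_asym: "distinct xs \<Longrightarrow> precedes xs x y \<Longrightarrow> \<not> precedes xs y x"
  by (induction xs) (auto dest: precedes_in_set)

lemma sorted_wrt_precedes: "sorted_wrt (precedes xs) xs"
proof (induction xs)
  case (Cons x xs)
  then show ?case by (auto elim: sorted_wrt_mono_rel[rotated])
qed simp

text \<open>Were the heads different, each would lie in the tail of the other list, so
  \<open>R\<close> would hold between them in both directions.\<close>

lemma sorted_wrt_asym_unique:
  assumes "\<And>x y. R x y \<Longrightarrow> \<not> R y x"
  shows "sorted_wrt R xs \<Longrightarrow> sorted_wrt R ys \<Longrightarrow> set xs = set ys \<Longrightarrow> xs = ys"
proof (induction xs arbitrary: ys)
  case (Cons x xs)
  then obtain y zs where ys: "ys = y # zs" by (cases ys) auto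
  have irrefl: "\<not> R z z" for z using assms by blast
  have "x = y"
  proof (rule ccontr)
    assume "x \<noteq> y"
    then have "y \<in> set xs" "x \<in> set zs" using Cons.prems ys by auto
    then show False using Cons.prems ys assms by auto
  qed
  moreover have "x \<notin> set xs" "y \<notin> set zs" using Cons.prems ys irrefl by auto
  ultimately have "set xs = set zs" using Cons.prems ys by auto
  then show ?case using Cons ys \<open>x = y\<close> by auto
qed simp

text \<open>Transitivity of \<open>precedes ys\<close> lifts the condition from adjacent to all
  pairs, and a list sorted for an asymmetric relation is determined by its entries. Read
  contrapositively, different arrangements already disagree on an adjacent pair; this is the source
  of ascents.\<close>

lemma eq_if_adjacent_precedes:
  assumes ys: "distinct ys" and set: "set xs = set ys"
    and adj: "\<And>us x y vs. xs = us @ x # y # vs \<Longrightarrow> precedes ys x y"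
  shows "xs = ys"
proof -
  have "successively (precedes ys) xs"
    unfolding successively_conv_nth
  proof (intro allI impI)
    fix i assume i: "Suc i < length xs"
    then have "xs = take i xs @ xs ! i # xs ! Suc i # drop (Suc (Suc i)) xs"
      by (simp add: Cons_nth_drop_Suc)
    then show "precedes ys (xs ! i) (xs ! Suc i)" by (rule adj)
  qed
  then have "sorted_wrt (precedes ys) xs"
    by (subst (asm) successively_iff_sorted_wrt_strong) (auto intro: precedes_trans[OF ys])
  then show ?thesis
    using precedes_asym[OF ys] sorted_wrt_precedes set
    by (intro sorted_wrt_asym_unique[of "precedes ys"]) auto
qed

text \<open>Serves both the exchange of an ascent, where \<open>gs\<close> is one entry, and the
  move of a letter across a whole block.\<close>

lemma precedes_move:
  assumes "distinct (us @ gs @ [y] @ ws)"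
  shows "precedes (us @ [y] @ gs @ ws) p q \<longleftrightarrow>
    precedes (us @ gs @ [y] @ ws) p q \<and> \<not> (p \<in> set gs \<and> q = y) \<or> p = y \<and> q \<in> set gs"
  using assms by (auto dest: precedes_in_set)

section \<open>Words of labelled occurrences\<close>

text \<open>The letters of \<open>xs\<close> are labelled by the numbers of their occurrences, \<open>c x\<close> being the
  number of occurrences of \<open>x\<close> to the left of \<open>xs\<close>.\<close>

primrec labels_from :: "('a \<Rightarrow> nat) \<Rightarrow> 'a list \<Rightarrow> ('a \<times> nat) list" where
  "labels_from c [] = []"
| "labels_from c (x # xs) = (x, Suc (c x)) # labels_from (c(x := Suc (c x))) xs"

abbreviation labels :: "'a list \<Rightarrow> ('a \<times> nat) list" where
  "labels \<equiv> labels_from (\<lambda>_. 0)"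

lemma map_fst_labels_from [simp]: "map fst (labels_from c xs) = xs"
  by (induction xs arbitrary: c) auto

lemma length_labels_from [simp]: "length (labels_from c xs) = length xs"
  by (induction xs arbitrary: c) auto

lemma labels_from_cong: "(\<And>x. x \<in> set xs \<Longrightarrow> c x = d x) \<Longrightarrow> labels_from c xs = labels_from d xs"
proof (induction xs arbitrary: c d)
  case (Cons x xs)
  have "labels_from (c(x := Suc (c x))) xs = labels_from (d(x := Suc (d x))) xs"
    by (rule Cons.IH) (use Cons.prems in auto)
  then show ?case using Cons.prems by simp
qed simp

lemma labels_from_append:
  "labels_from c (xs @ ys) = labels_from c xs @ labels_from (\<lambda>x. c x + count_list xs x) ys"
proof (induction xs arbitrary: c)
  case (Cons x xs)
  show ?case by (auto simp: Cons.IH intro!: labels_from_cong)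
qed simp

lemma nth_labels_from:
  "p < length xs \<Longrightarrow>
     labels_from c xs ! p = (xs ! p, c (xs ! p) + count_list (take (Suc p) xs) (xs ! p))"
proof (induction xs arbitrary: c p)
  case (Cons x xs)
  then show ?case by (cases p) auto
qed simp

lemma set_labels_from:
  "set (labels_from c xs) = {(x, i). c x < i \<and> i \<le> c x + count_list xs x}"
proof (induction xs arbitrary: c)
  case (Cons x xs)
  show ?case by (auto simp: Cons.IH split: if_splits)
qed auto

lemma distinct_labels_from [simp]: "distinct (labels_from c xs)"
  by (induction xs arbitrary: c) (auto simp: set_labels_from)

text \<open>Numbers of equal letters grow from left to right, so two words never disagree on the
  order of two occurrences of one letter.\<close>

lemma precedes_labels_from_same: "precedes (labels_from c xs) (a, i) (a, j) \<Longrightarrow> i < j"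
  by (induction xs arbitrary: c) (auto simp: set_labels_from split: if_splits)

lemma labels_from_inject [simp]: "labels_from c xs = labels_from c ys \<longleftrightarrow> xs = ys"
  by (metis map_fst_labels_from)

lemma set_labels_mset_eq: "mset xs = mset ys \<Longrightarrow> set (labels xs) = set (labels ys)"
  by (simp add: set_labels_from flip: count_mset)

text \<open>Since \<open>F\<close> contains no \<open>b\<close>, no letter passes an equal one, and
  every occurrence keeps its number.\<close>

lemma labels_move:
  assumes "b \<notin> set F"
  obtains U G y W where "labels (u @ F @ [b] @ w) = U @ G @ [y] @ W"
    "labels (u @ [b] @ F @ w) = U @ [y] @ G @ W"
    "map fst U = u" "map fst G = F" "fst y = b" "map fst W = w"
proof -
  let ?c = "count_list u"
  let ?d = "\<lambda>x. count_list (u @ F @ [b]) x"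
  let ?y = "(b, Suc (?c b))"
  have F: "labels_from (?c(b := Suc (?c b))) F = labels_from ?c F"
    using assms by (intro labels_from_cong) auto
  have 1: "labels (u @ F @ [b] @ w) = labels u @ labels_from ?c F @ [?y] @ labels_from ?d w"
    using assms by (auto simp: labels_from_append intro!: labels_from_cong)
  have 2: "labels (u @ [b] @ F @ w) = labels u @ [?y] @ labels_from ?c F @ labels_from ?d w"
    using assms F by (auto simp: labels_from_append intro!: labels_from_cong)
  show ?thesis using that[OF 1 2] by simp
qed

section \<open>Co-inversions and ascents\<close>

text \<open>Position \<open>p\<close> of \<open>labels \<sigma>\<close> carries
  \<open>occurrence \<sigma> p\<close>, so positions can be given up in favour of the distinct
  labels.\<close>

lemma coinv_eq: "coinv \<sigma> = {(x, y). fst x < fst y \<and> precedes (labels \<sigma>) y x}"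
proof -
  have l: "labels \<sigma> ! p = occurrence \<sigma> p" if "p < length \<sigma>" for p
    using that by (simp add: nth_labels_from occurrence_def)
  have "(\<exists>q p. q < p \<and> p < length \<sigma> \<and> occurrence \<sigma> q = y \<and> occurrence \<sigma> p = x) \<longleftrightarrow>
      precedes (labels \<sigma>) y x" for x y
    unfolding precedes_conv_nth length_labels_from
    by (intro ex_cong1) (auto simp: l)
  then show ?thesis unfolding coinv_def by fastforce
qed

text \<open>The pairs undone by the move have the smaller letter first and are no co-inversions, so
  nothing is lost.\<close>

lemma coinv_move:
  assumes "labels \<sigma> = U @ G @ [y] @ W" "labels \<mu> = U @ [y] @ G @ W"
    and "\<And>x. x \<in> set G \<Longrightarrow> fst x < fst y"
  shows "coinv \<mu> = coinv \<sigma> \<union> set G \<times> {y}"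
proof -
  have "distinct (labels \<sigma>)" by simp
  then have "precedes (labels \<mu>) q p \<longleftrightarrow>
      precedes (labels \<sigma>) q p \<and> \<not> (q \<in> set G \<and> p = y) \<or> q = y \<and> p \<in> set G" for p q
    unfolding assms(1,2) by (rule precedes_move)
  moreover have "\<not> fst y < fst x" if "x \<in> set G" for x using assms(3)[OF that] by simp
  ultimately show ?thesis unfolding coinv_eq using assms(3) by auto
qed

text \<open>Some adjacent pair of \<open>labels \<sigma>\<close> is reversed in
  \<open>\<tau>\<close>. Its letters differ, because equal letters keep their order, and it is no
  descent, because a co-inversion of \<open>\<sigma>\<close> persists in
  \<open>\<tau>\<close>.\<close>

lemma coinv_subset_imp_ascent:
  assumes "mset \<sigma> = mset \<tau>" "coinv \<sigma> \<subseteq> coinv \<tau>" "\<sigma> \<noteq> \<tau>"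
  obtains U x y W where "labels \<sigma> = U @ x # y # W" "fst x < fst y" "(x, y) \<in> coinv \<tau>"
proof -
  have "labels \<sigma> \<noteq> labels \<tau>" using assms(3) by simp
  then obtain U x y W where s: "labels \<sigma> = U @ x # y # W" and n: "\<not> precedes (labels \<tau>) x y"
    using eq_if_adjacent_precedes[OF distinct_labels_from set_labels_mset_eq[OF assms(1)]]
    by metis
  have xy: "x \<in> set (labels \<tau>)" "y \<in> set (labels \<tau>)"
    using s set_labels_mset_eq[OF assms(1)]
    by (metis in_set_conv_decomp list.set_intros(1,2) Un_iff set_append)+
  have "distinct (U @ x # y # W)" using s distinct_labels_from by metis
  then have "x \<noteq> y" by auto
  then have p: "precedes (labels \<tau>) y x" using n xy precedes_total by metis
  have q: "precedes (labels \<sigma>) x y" by (simp add: s)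
  have "fst x \<noteq> fst y"
    using precedes_labels_from_same p q by (metis less_asym prod.collapse)
  moreover have "\<not> fst y < fst x"
  proof
    assume "fst y < fst x"
    then have "(y, x) \<in> coinv \<sigma>" using q by (simp add: coinv_eq)
    then show False using assms(2) n by (auto simp: coinv_eq)
  qed
  ultimately have "fst x < fst y" by simp
  with that[OF s] p show ?thesis by (simp add: coinv_eq)
qed

text \<open>Antisymmetry of the order: otherwise an ascent of \<open>\<sigma>\<close> would be a
  co-inversion of \<open>\<sigma>\<close> itself.\<close>

lemma coinv_inject:
  assumes "mset \<sigma> = mset \<tau>" "coinv \<sigma> = coinv \<tau>"
  shows "\<sigma> = \<tau>"
proof (rule ccontr)
  assume "\<sigma> \<noteq> \<tau>"
  then obtain U x y W where s: "labels \<sigma> = U @ x # y # W" and xy: "(x, y) \<in> coinv \<sigma>"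
    using coinv_subset_imp_ascent[OF assms(1)] assms(2) by (metis subset_refl)
  then have "precedes (labels \<sigma>) x y" "precedes (labels \<sigma>) y x" by (auto simp: coinv_eq)
  then show False using precedes_asym distinct_labels_from by metis
qed

section \<open>Pattern avoidance and single steps\<close>

text \<open>Expressed with labels instead of letters, so that totality and transitivity of
  \<open>precedes\<close> on distinct entries apply; \<open>x\<close> and \<open>z\<close> are two
  occurrences of one letter with \<open>y\<close> between them.\<close>

definition avoiding :: "nat list \<Rightarrow> bool" where
  "avoiding \<sigma> \<longleftrightarrow> (\<forall>x y z. precedes (labels \<sigma>) x y \<longrightarrow> precedes (labels \<sigma>) y z \<longrightarrow>
     fst x = fst z \<longrightarrow> fst y \<le> fst x)"

lemma avoidingD:
  "avoiding \<sigma> \<Longrightarrow> precedes (labels \<sigma>) x y \<Longrightarrow> precedes (labels \<sigma>) y z \<Longrightarrow> fst x = fst z \<Longrightarrow>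
     fst y \<le> fst x"
  unfolding avoiding_def by blast

lemma precedes_imp_decomp: "precedes xs x y \<Longrightarrow> \<exists>us vs ws. xs = us @ x # vs @ y # ws"
proof (induction xs)
  case (Cons z zs)
  show ?case
  proof (cases "z = x \<and> y \<in> set zs")
    case True
    then show ?thesis by (metis append_Nil split_list)
  next
    case False
    then show ?thesis using Cons by (metis append_Cons precedes.simps(2))
  qed
qed simp

lemma precedes2_imp_decomp:
  assumes "distinct xs" "precedes xs x y" "precedes xs y z"
  obtains us vs ws ts where "xs = us @ x # vs @ y # ws @ z # ts"
proof -
  obtain us vs ws where xs: "xs = us @ x # vs @ y # ws"
    using precedes_imp_decomp[OF assms(2)] by blast
  then have "z \<in> set ws" using assms(1,3) by (auto dest: precedes_in_set)
  then obtain ws' ts where "ws = ws' @ z # ts" by (meson split_list)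
  then show ?thesis using that xs by simp
qed

text \<open>Take the first letter \<open>c > a\<close> after the left \<open>a\<close> of a pattern.
  Its left neighbour is at most \<open>a\<close>. If it equals \<open>a\<close>, the first rule
  applies with the right \<open>a\<close> as witness; if it is smaller, the second rule applies,
  enclosed by the two letters \<open>a\<close>.\<close>

lemma step_if_not_avoiding:
  assumes "\<not> avoiding \<sigma>"
  obtains \<tau> where "metasylvester_step \<sigma> \<tau>"
proof -
  obtain x y z where p: "precedes (labels \<sigma>) x y" "precedes (labels \<sigma>) y z"
    and xy: "fst x = fst z" "fst x < fst y"
    using assms by (auto simp: avoiding_def not_le)
  obtain us vs ws ts where "labels \<sigma> = us @ x # vs @ y # ws @ z # ts"
    using precedes2_imp_decomp[OF distinct_labels_from p] by blast
  then have "map fst (labels \<sigma>) = map fst (us @ x # vs @ y # ws @ z # ts)" by simp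
  then obtain u v w t a b where s: "\<sigma> = u @ a # v @ b # w @ a # t" and ab: "a < b"
    using xy by auto
  have "\<exists>c\<in>set (v @ [b]). a < c" using ab by auto
  then obtain v1 c v2 where v: "v @ [b] = v1 @ c # v2" "a < c" "\<forall>d\<in>set v1. \<not> a < d"
    by (rule split_list_first_propE)
  have "\<sigma> = u @ a # (v @ [b]) @ w @ a # t" using s by simp
  then have s': "\<sigma> = u @ a # v1 @ c # v2 @ w @ a # t" unfolding v(1) by simp
  show ?thesis
  proof (cases v1 rule: rev_cases)
    case Nil
    then show ?thesis
      using that s' metasylvester_step.intros(1)[OF v(2), of u "v2 @ w" t] by simp
  next
    case (snoc v1' d)
    then have "d \<le> a" using v(3) by auto
    then consider "d = a" | "d < a" by linarith
    then show ?thesis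
    proof cases
      case 1
      then show ?thesis
        using that s' snoc metasylvester_step.intros(1)[OF v(2), of "u @ a # v1'" "v2 @ w" t]
        by simp
    next
      case 2
      then show ?thesis
        using that s' snoc metasylvester_step.intros(2)[OF 2 v(2), of u v1' "v2 @ w" t] by simp
    qed
  qed
qed

lemma metasylvester_step_swap:
  assumes "metasylvester_step \<sigma> \<tau>"
  obtains u a c w where "\<sigma> = u @ [a] @ [c] @ w" "\<tau> = u @ [c] @ [a] @ w" "a < c"
  using assms
proof cases
  case (1 a c u v w)
  then show ?thesis using that[of u a c "v @ [a] @ w"] by simp
next
  case (2 a b c u v w x)
  then show ?thesis using that[of "u @ [b] @ v" a c "w @ [b] @ x"] by simp
qed

lemma mset_metasylvester_step: "metasylvester_step \<sigma> \<tau> \<Longrightarrow> mset \<sigma> = mset \<tau>"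
  by (erule metasylvester_step_swap) simp

text \<open>The one-letter case of \<open>labels_move\<close> and \<open>coinv_move\<close>. The
  added pair is new because \<open>x\<close> stands before \<open>y\<close> in the original
  word.\<close>

lemma coinv_swap:
  assumes "a < b"
  shows "\<exists>U x y W. labels (u @ [a] @ [b] @ w) = U @ x # y # W \<and>
    labels (u @ [b] @ [a] @ w) = U @ y # x # W \<and> map fst U = u \<and> fst x = a \<and> fst y = b \<and>
    map fst W = w \<and> coinv (u @ [b] @ [a] @ w) = insert (x, y) (coinv (u @ [a] @ [b] @ w)) \<and>
    (x, y) \<notin> coinv (u @ [a] @ [b] @ w)"
proof -
  have "b \<notin> set [a]" using assms by simp
  from labels_move[OF this, of u w] obtain U G y W where
    l: "labels (u @ [a] @ [b] @ w) = U @ G @ [y] @ W" "labels (u @ [b] @ [a] @ w) = U @ [y] @ G @ W"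
      "map fst U = u" "map fst G = [a]" "fst y = b" "map fst W = w" .
  then obtain x where G: "G = [x]" "fst x = a" by auto
  have "coinv (u @ [b] @ [a] @ w) = coinv (u @ [a] @ [b] @ w) \<union> set G \<times> {y}"
    using coinv_move[OF l(1,2)] G l(5) assms by simp
  moreover have "(x, y) \<notin> coinv (u @ [a] @ [b] @ w)"
  proof
    assume "(x, y) \<in> coinv (u @ [a] @ [b] @ w)"
    then have "precedes (labels (u @ [a] @ [b] @ w)) y x" by (simp add: coinv_eq)
    moreover have "precedes (labels (u @ [a] @ [b] @ w)) x y" using l(1) G by simp
    ultimately show False using precedes_asym distinct_labels_from by metis
  qed
  ultimately show ?thesis using l G by (intro exI[of _ U] exI[of _ x] exI[of _ y] exI[of _ W]) simp
qed

lemma coinv_step: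
  assumes "metasylvester_step \<sigma> \<tau>"
  shows "coinv \<sigma> \<subset> coinv \<tau>"
proof -
  obtain u a c w where "\<sigma> = u @ [a] @ [c] @ w" "\<tau> = u @ [c] @ [a] @ w" "a < c"
    using metasylvester_step_swap[OF assms] .
  with coinv_swap[of a c u w] show ?thesis by auto
qed

section \<open>An invariant of the congruence\<close>

text \<open>Which \<open>a\<close> is passed is forgotten on purpose: an exchange by the first rule
  then changes nothing, as another \<open>a\<close> still follows.\<close>

definition some_after :: "nat list \<Rightarrow> nat \<Rightarrow> nat \<times> nat \<Rightarrow> bool" where
  "some_after \<sigma> a y \<longleftrightarrow> a < fst y \<and> (\<exists>i. precedes (labels \<sigma>) y (a, i))"

text \<open>Transitive closure for a relation between letters and labels: a link ending in
  \<open>(b, j)\<close> continues from the letter \<open>b\<close>, regardless of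
  \<open>j\<close>.\<close>

inductive chain :: "(nat \<Rightarrow> nat \<times> nat \<Rightarrow> bool) \<Rightarrow> nat \<Rightarrow> nat \<times> nat \<Rightarrow> bool"
  for P where
  base: "P a y \<Longrightarrow> chain P a y"
| link: "P a (b, j) \<Longrightarrow> chain P b y \<Longrightarrow> chain P a y"

lemma chain_trans: "chain P a x \<Longrightarrow> chain P (fst x) y \<Longrightarrow> chain P a y"
proof (induction rule: chain.induct)
  case (base a x)
  then show ?case by (metis chain.link prod.collapse)
qed (blast intro: chain.link)

text \<open>Applied with \<open>P\<close> and \<open>Q\<close> the relations before and after a
  step.\<close>

lemma chain_between:
  assumes "P \<le> Q" "Q \<le> chain P"
  shows "chain Q = chain P"
proof (intro ext iffI)
  fix a y
  show "chain P a y" if "chain Q a y" using that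
  proof (induction rule: chain.induct)
    case (base a y)
    then show ?case using assms(2) by blast
  next
    case (link a b j y)
    then show ?case using assms(2) chain_trans[of P a "(b, j)" y] by auto
  qed
  show "chain Q a y" if "chain P a y" using that
    by (induction rule: chain.induct) (use assms(1) in \<open>auto intro: chain.intros\<close>)
qed

text \<open>A step by the second rule may put \<open>c\<^sub>j\<close> before the last \<open>a\<close>, but even without it
  \<open>c\<^sub>j\<close> precedes some \<open>b\<close>, and some \<open>b\<close> precedes that \<open>a\<close>.\<close>

lemma chain_step:
  assumes "metasylvester_step \<sigma> \<tau>"
  shows "chain (some_after \<tau>) = chain (some_after \<sigma>)"
proof -
  \<comment> \<open>Both rules exchange adjacent letters \<open>a\<close> and \<open>c\<close>; only
    the witness differs, an \<open>a\<close> to the right or a \<open>b\<close> on both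
    sides.\<close>
  have main: "chain (some_after (u @ [c] @ [a] @ w)) = chain (some_after (u @ [a] @ [c] @ w))"
    if "a < c" and w: "a \<in> set w \<or> (\<exists>b. a < b \<and> b < c \<and> b \<in> set u \<and> b \<in> set w)" for u w a c
  proof -
    obtain U x y W where l: "labels (u @ [a] @ [c] @ w) = U @ x # y # W"
        "labels (u @ [c] @ [a] @ w) = U @ y # x # W" "map fst U = u" "fst x = a" "fst y = c"
        "map fst W = w"
      using coinv_swap[OF \<open>a < c\<close>] by blast
    have le: "some_after (u @ [a] @ [c] @ w) \<le> some_after (u @ [c] @ [a] @ w)"
      using l \<open>a < c\<close> by (auto simp: some_after_def)
    have xy: "chain (some_after (u @ [a] @ [c] @ w)) a y"
      using w
    proof
      assume "a \<in> set w"
      then obtain i where "(a, i) \<in> set W" using l(6) by force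
      then show ?thesis using l \<open>a < c\<close> by (auto simp: some_after_def intro!: chain.base)
    next
      assume "\<exists>b. a < b \<and> b < c \<and> b \<in> set u \<and> b \<in> set w"
      then obtain b where b: "a < b" "b < c" "b \<in> set u" "b \<in> set w" by blast
      then obtain i j where ij: "(b, i) \<in> set U" "(b, j) \<in> set W" using l(3,6) by force
      have "x = (a, snd x)" using l(4) by auto
      then have "some_after (u @ [a] @ [c] @ w) a (b, i)"
        using l b ij unfolding some_after_def by (intro conjI exI[of _ "snd x"]) auto
      moreover have "some_after (u @ [a] @ [c] @ w) b y"
        using l b ij unfolding some_after_def by (intro conjI exI[of _ j]) auto
      ultimately show ?thesis by (blast intro: chain.intros)
    qed
    have "some_after (u @ [c] @ [a] @ w) d z \<Longrightarrow> chain (some_after (u @ [a] @ [c] @ w)) d z" for d z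
    proof -
      assume d: "some_after (u @ [c] @ [a] @ w) d z"
      show ?thesis
      proof (cases "d = a \<and> z = y")
        case False
        then have "some_after (u @ [a] @ [c] @ w) d z"
          using d l by (auto simp: some_after_def)
        then show ?thesis by (rule chain.base)
      qed (use xy in simp)
    qed
    then show ?thesis using chain_between[OF le] by blast
  qed
  from assms show ?thesis
  proof cases
    case (1 a c u v w)
    then show ?thesis using main[of a c "v @ [a] @ w" u] by simp
  next
    case (2 a b c u v w x)
    then show ?thesis using main[of a c "w @ [b] @ x" "u @ [b] @ v"] by auto
  qed
qed

text \<open>Let \<open>b_j\<close> precede an \<open>a\<close>, and let \<open>y\<close>, with a
  letter above \<open>b\<close>, precede some \<open>b_k\<close>. If \<open>b_j\<close> came before
  \<open>y\<close>, then \<open>b_j\<close>, \<open>y\<close>, \<open>b_k\<close> would be a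
  forbidden pattern; so \<open>y\<close> comes before \<open>b_j\<close> and hence before that
  \<open>a\<close>.\<close>

lemma chain_avoiding:
  assumes "avoiding \<sigma>"
  shows "chain (some_after \<sigma>) = some_after \<sigma>"
proof (intro ext iffI)
  fix a y
  show "some_after \<sigma> a y" if "chain (some_after \<sigma>) a y" using that
  proof (induction rule: chain.induct)
    case (link a b j y)
    obtain i k where i: "a < b" "precedes (labels \<sigma>) (b, j) (a, i)"
      and k: "b < fst y" "precedes (labels \<sigma>) y (b, k)"
      using link by (auto simp: some_after_def)
    have "\<not> precedes (labels \<sigma>) (b, j) y" using avoidingD[OF assms _ k(2), of "(b, j)"] k(1) by auto
    moreover have "y \<noteq> (b, j)" using k(1) by auto
    ultimately have "precedes (labels \<sigma>) y (b, j)"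
      using precedes_total[of y "labels \<sigma>" "(b, j)"] precedes_in_set[OF i(2)]
        precedes_in_set[OF k(2)] by auto
    then have "precedes (labels \<sigma>) y (a, i)" using i precedes_trans distinct_labels_from by metis
    then show ?case using i k by (auto simp: some_after_def)
  qed
qed (rule chain.base)

text \<open>A larger \<open>y\<close> preceding one occurrence of the letter of \<open>x\<close>
  must precede \<open>x\<close> too, since otherwise \<open>x\<close>, \<open>y\<close> and that
  occurrence form the pattern. Hence \<open>some_after\<close> determines all co-inversions.\<close>

lemma coinv_avoiding:
  assumes "avoiding \<sigma>"
  shows "coinv \<sigma> = {(x, y). x \<in> set (labels \<sigma>) \<and> some_after \<sigma> (fst x) y}"
proof (intro set_eqI iffI)
  fix p assume "p \<in> coinv \<sigma>"
  then show "p \<in> {(x, y). x \<in> set (labels \<sigma>) \<and> some_after \<sigma> (fst x) y}"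
    by (force simp: coinv_eq some_after_def dest: precedes_in_set)
next
  fix p assume "p \<in> {(x, y). x \<in> set (labels \<sigma>) \<and> some_after \<sigma> (fst x) y}"
  then obtain x y i where p: "p = (x, y)" and x: "x \<in> set (labels \<sigma>)" "fst x < fst y"
    and y: "precedes (labels \<sigma>) y (fst x, i)"
    by (auto simp: some_after_def)
  have "\<not> precedes (labels \<sigma>) x y" using avoidingD[OF assms _ y, of x] x by auto
  then have "precedes (labels \<sigma>) y x"
    using x precedes_total[of y "labels \<sigma>" x] precedes_in_set[OF y] by auto
  then show "p \<in> coinv \<sigma>" using x p by (simp add: coinv_eq)
qed

lemma avoiding_unique:
  assumes "avoiding \<sigma>" "avoiding \<tau>" "mset \<sigma> = mset \<tau>"
    "chain (some_after \<sigma>) = chain (some_after \<tau>)"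
  shows "\<sigma> = \<tau>"
proof (rule coinv_inject[OF assms(3)])
  have "some_after \<sigma> = some_after \<tau>" using assms chain_avoiding by metis
  then show "coinv \<sigma> = coinv \<tau>"
    using assms by (simp add: coinv_avoiding set_labels_mset_eq[OF assms(3)])
qed

section \<open>Congruence classes and their maximal elements\<close>

lemma mperms_cong_mset: "\<sigma> \<in> mperms m n \<Longrightarrow> mset \<tau> = mset \<sigma> \<Longrightarrow> \<tau> \<in> mperms m n"
  by (simp add: mperms_def permutations_of_multiset_def)

lemma mset_mperms: "\<sigma> \<in> mperms m n \<Longrightarrow> \<tau> \<in> mperms m n \<Longrightarrow> mset \<sigma> = mset \<tau>"
  by (simp add: mperms_def permutations_of_multiset_def)

lemma count_list_mperms:
  assumes "\<sigma> \<in> mperms m n" "a \<in> set \<sigma>"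
  shows "count_list \<sigma> a = m"
proof -
  have "count (mset \<sigma>) a = (\<Sum>b = 1..n. if a = b then m else 0)"
    using assms(1) by (simp add: mperms_def permutations_of_multiset_def count_sum)
  also have "\<dots> = (if a \<in> {1..n} then m else 0)" by (subst sum.delta') auto
  finally have "count_list \<sigma> a = (if a \<in> {1..n} then m else 0)" by (simp add: count_mset)
  moreover have "count_list \<sigma> a \<noteq> 0" using assms(2) by (simp add: count_list_0_iff)
  ultimately show ?thesis by (simp split: if_splits)
qed

lemma metasylvester_cong_refl: "metasylvester_cong m n \<sigma> \<sigma>"
  by (simp add: metasylvester_cong_def)

lemma metasylvester_cong_trans:
  "metasylvester_cong m n \<rho> \<sigma> \<Longrightarrow> metasylvester_cong m n \<sigma> \<tau> \<Longrightarrow> metasylvester_cong m n \<rho> \<tau>"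
  unfolding metasylvester_cong_def by (rule equivclp_trans)

lemma metasylvester_cong_sym:
  "metasylvester_cong m n \<sigma> \<tau> \<Longrightarrow> metasylvester_cong m n \<tau> \<sigma>"
  unfolding metasylvester_cong_def by (rule equivclp_sym)

lemma metasylvester_cong_step:
  "\<sigma> \<in> mperms m n \<Longrightarrow> metasylvester_step \<sigma> \<tau> \<Longrightarrow> metasylvester_cong m n \<sigma> \<tau>"
  unfolding metasylvester_cong_def
  using mperms_cong_mset mset_metasylvester_step by (intro r_into_equivclp) metis

lemma chain_cong:
  assumes "metasylvester_cong m n \<sigma> \<tau>"
  shows "chain (some_after \<sigma>) = chain (some_after \<tau>)"
  using assms unfolding metasylvester_cong_def
  by (induction rule: equivclp_induct) (metis chain_step)+

text \<open>Classes are finite. A maximal set of co-inversions is chosen first, and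
  \<open>coinv_inject\<close> turns it into a maximal word.\<close>

lemma maximal_above:
  assumes "\<rho> \<in> metasylvester_class m n \<sigma>"
  obtains \<tau> where "maximal_in_class m n \<sigma> \<tau>" "mperm_le \<rho> \<tau>"
proof -
  let ?C = "metasylvester_class m n \<sigma>"
  have "finite (coinv ` ?C)" by (simp add: metasylvester_class_def mperms_def)
  from finite_has_maximal2[OF this imageI[OF assms]] obtain \<tau>
    where t: "\<tau> \<in> ?C" "coinv \<rho> \<subseteq> coinv \<tau>" "\<And>\<tau>'. \<tau>' \<in> ?C \<Longrightarrow> coinv \<tau> \<subseteq> coinv \<tau>' \<Longrightarrow> coinv \<tau> = coinv \<tau>'"
    by auto
  have "\<not> mperm_less \<tau> \<tau>'" if t': "\<tau>' \<in> ?C" for \<tau>'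
  proof
    assume "mperm_less \<tau> \<tau>'"
    then have "coinv \<tau> = coinv \<tau>'" "\<tau> \<noteq> \<tau>'"
      using t(3)[OF t'] by (auto simp: mperm_less_def mperm_le_def)
    moreover have "mset \<tau> = mset \<tau>'"
      using t(1) t' mset_mperms by (auto simp: metasylvester_class_def)
    ultimately show False using coinv_inject by blast
  qed
  then show ?thesis using that[of \<tau>] t by (auto simp: maximal_in_class_def mperm_le_def)
qed

lemma maximal_imp_avoiding:
  assumes "maximal_in_class m n \<sigma> \<tau>"
  shows "avoiding \<tau>"
proof (rule ccontr)
  assume "\<not> avoiding \<tau>"
  then obtain \<tau>' where s: "metasylvester_step \<tau> \<tau>'" by (rule step_if_not_avoiding)
  have t: "\<tau> \<in> mperms m n" "metasylvester_cong m n \<sigma> \<tau>"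
    using assms by (auto simp: maximal_in_class_def metasylvester_class_def)
  then have "\<tau>' \<in> metasylvester_class m n \<sigma>"
    using metasylvester_cong_trans[OF t(2) metasylvester_cong_step[OF t(1) s]]
      mperms_cong_mset[OF t(1)] mset_metasylvester_step[OF s]
    by (simp add: metasylvester_class_def)
  moreover have "mperm_less \<tau> \<tau>'"
    using coinv_step[OF s] by (auto simp: mperm_less_def mperm_le_def)
  ultimately show False using assms by (auto simp: maximal_in_class_def)
qed

lemma avoiding_unique_in_class:
  assumes "\<tau> \<in> metasylvester_class m n \<sigma>" "\<tau>' \<in> metasylvester_class m n \<sigma>"
    "avoiding \<tau>" "avoiding \<tau>'"
  shows "\<tau> = \<tau>'"
proof (rule avoiding_unique[OF assms(3,4)])
  show "mset \<tau> = mset \<tau>'" using assms mset_mperms by (auto simp: metasylvester_class_def)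
  have "metasylvester_cong m n \<tau> \<tau>'"
    using assms(1,2) by (auto simp: metasylvester_class_def
        intro: metasylvester_cong_sym metasylvester_cong_trans)
  then show "chain (some_after \<tau>) = chain (some_after \<tau>')" by (rule chain_cong)
qed

text \<open>If \<open>\<tau>\<close> avoids the pattern and \<open>\<rho>\<close> in the class lies
  above it, a maximal element above \<open>\<rho>\<close> avoids the pattern as well, hence is
  \<open>\<tau>\<close> by uniqueness, and \<open>\<rho>\<close> is squeezed in between.\<close>

lemma maximal_in_class_iff:
  "maximal_in_class m n \<sigma> \<tau> \<longleftrightarrow> \<tau> \<in> metasylvester_class m n \<sigma> \<and> avoiding \<tau>"
proof (intro iffI conjI)
  assume t: "\<tau> \<in> metasylvester_class m n \<sigma> \<and> avoiding \<tau>"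
  have "\<not> mperm_less \<tau> \<rho>" if r: "\<rho> \<in> metasylvester_class m n \<sigma>" for \<rho>
  proof
    assume less: "mperm_less \<tau> \<rho>"
    obtain \<tau>' where t': "maximal_in_class m n \<sigma> \<tau>'" "mperm_le \<rho> \<tau>'" using maximal_above[OF r] .
    then have "\<tau>' = \<tau>"
      using t maximal_imp_avoiding avoiding_unique_in_class maximal_in_class_def by blast
    then have "coinv \<tau> = coinv \<rho>" using t' less by (auto simp: mperm_less_def mperm_le_def)
    moreover have "mset \<tau> = mset \<rho>" using t r mset_mperms by (auto simp: metasylvester_class_def)
    ultimately show False using coinv_inject less by (auto simp: mperm_less_def)
  qed
  then show "maximal_in_class m n \<sigma> \<tau>" using t by (auto simp: maximal_in_class_def)
qed (auto simp: maximal_in_class_def intro: maximal_imp_avoiding[unfolded maximal_in_class_def])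

lemma Max_mperms_eq: "Max_mperms m n = {\<tau> \<in> mperms m n. avoiding \<tau>}"
  using metasylvester_cong_refl
  by (auto simp: Max_mperms_def maximal_in_class_iff metasylvester_class_def)

lemma MaxClass_eq:
  assumes "\<tau> \<in> mperms m n" "metasylvester_cong m n \<sigma> \<tau>" "avoiding \<tau>"
  shows "MaxClass m n \<sigma> = \<tau>"
  unfolding MaxClass_def
proof (rule the_equality)
  show t: "maximal_in_class m n \<sigma> \<tau>"
    using assms by (simp add: maximal_in_class_iff metasylvester_class_def)
  show "\<rho> = \<tau>" if "maximal_in_class m n \<sigma> \<rho>" for \<rho>
    using that t avoiding_unique_in_class by (auto simp: maximal_in_class_iff)
qed

section \<open>Covers in the \<open>m\<close>-permutations lattice\<close>

lemma coinv_subset_imp_swap: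
  assumes "mset \<sigma> = mset \<tau>" "coinv \<sigma> \<subseteq> coinv \<tau>" "\<sigma> \<noteq> \<tau>"
  obtains u a b w where "\<sigma> = u @ [a] @ [b] @ w" "a < b"
    "coinv (u @ [b] @ [a] @ w) \<subseteq> coinv \<tau>"
proof -
  obtain U x y W where l: "labels \<sigma> = U @ x # y # W" "fst x < fst y" "(x, y) \<in> coinv \<tau>"
    using coinv_subset_imp_ascent[OF assms] .
  define u a b w where "u = map fst U" "a = fst x" "b = fst y" "w = map fst W"
  have "map fst (labels \<sigma>) = u @ [a] @ [b] @ w" unfolding l(1) by (simp add: u_a_b_w_def)
  then have s: "\<sigma> = u @ [a] @ [b] @ w" by simp
  have ab: "a < b" using l by (simp add: u_a_b_w_def)
  obtain U' x' y' W' where l': "labels \<sigma> = U' @ x' # y' # W'" "map fst U' = u"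
      "coinv (u @ [b] @ [a] @ w) = insert (x', y') (coinv \<sigma>)"
    using coinv_swap[OF ab] unfolding s by blast
  \<comment> \<open>Equal prefix lengths identify the pair exchanged in \<open>coinv_swap\<close>
    with the ascent found before.\<close>
  have "length U' = length U" using l'(2) u_a_b_w_def(1) by (metis length_map)
  then have "x' = x" "y' = y" using l(1) l'(1) by auto
  then show ?thesis using that[OF s ab] l(3) l'(3) assms(2) by auto
qed

text \<open>Every larger word lies above the exchange of some ascent, and such an exchange adds a
  single co-inversion, which leaves no room in between.\<close>

lemma successors_mperms:
  assumes "\<sigma> \<in> mperms m n"
  shows "successors (mperms m n) \<sigma> =
    {\<tau>. \<exists>u a b w. a < b \<and> \<sigma> = u @ [a] @ [b] @ w \<and> \<tau> = u @ [b] @ [a] @ w}"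
proof (intro set_eqI iffI)
  fix \<tau> assume "\<tau> \<in> successors (mperms m n) \<sigma>"
  then have t: "\<tau> \<in> mperms m n" "coinv \<sigma> \<subseteq> coinv \<tau>" "\<sigma> \<noteq> \<tau>"
      "\<And>z. z \<in> mperms m n \<Longrightarrow> mperm_less \<sigma> z \<Longrightarrow> \<not> mperm_less z \<tau>"
    by (auto simp: successors_def mperm_less_def mperm_le_def)
  obtain u a b w where s: "\<sigma> = u @ [a] @ [b] @ w" "a < b" "coinv (u @ [b] @ [a] @ w) \<subseteq> coinv \<tau>"
    using coinv_subset_imp_swap[OF mset_mperms[OF assms t(1)] t(2,3)] .
  let ?z = "u @ [b] @ [a] @ w"
  have "?z \<in> mperms m n" using mperms_cong_mset[OF assms] s by simp
  moreover have "mperm_less \<sigma> ?z"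
    using coinv_swap[OF s(2), of u w] s(1,2) by (auto simp: mperm_less_def mperm_le_def)
  ultimately have "?z = \<tau>" using t(4) s(3) by (auto simp: mperm_less_def mperm_le_def)
  then show "\<tau> \<in> {\<tau>. \<exists>u a b w. a < b \<and> \<sigma> = u @ [a] @ [b] @ w \<and> \<tau> = u @ [b] @ [a] @ w}"
    using s by blast
next
  fix \<tau> assume "\<tau> \<in> {\<tau>. \<exists>u a b w. a < b \<and> \<sigma> = u @ [a] @ [b] @ w \<and> \<tau> = u @ [b] @ [a] @ w}"
  then obtain u a b w where s: "a < b" "\<sigma> = u @ [a] @ [b] @ w" "\<tau> = u @ [b] @ [a] @ w" by blast
  have t: "\<tau> \<in> mperms m n" using mperms_cong_mset[OF assms] s by simp
  obtain x y where c: "coinv \<tau> = insert (x, y) (coinv \<sigma>)"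
    using coinv_swap[OF s(1)] unfolding s(2,3) by blast
  have "\<not> (mperm_less \<sigma> z \<and> mperm_less z \<tau>)" if z: "z \<in> mperms m n" for z
  proof
    assume "mperm_less \<sigma> z \<and> mperm_less z \<tau>"
    then have "coinv z = coinv \<sigma> \<or> coinv z = coinv \<tau>" "z \<noteq> \<sigma>" "z \<noteq> \<tau>"
      using c by (auto simp: mperm_less_def mperm_le_def)
    then show False using coinv_inject mset_mperms z t assms by metis
  qed
  moreover have "mperm_less \<sigma> \<tau>" using c s by (auto simp: mperm_less_def mperm_le_def)
  ultimately show "\<tau> \<in> successors (mperms m n) \<sigma>" using t by (auto simp: successors_def)
qed

section \<open>Block moves\<close>

text \<open>\<open>F\<close> is the factor from the first to the last \<open>a\<close>. Fixing only
  its two ends by \<open>hd\<close> and \<open>last\<close> covers the one-letter block of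
  \<open>m = 1\<close> without a separate case.\<close>

definition block_move ::
  "nat list \<Rightarrow> nat list \<Rightarrow> nat \<Rightarrow> nat \<Rightarrow> nat list \<Rightarrow> nat list \<Rightarrow> nat list \<Rightarrow> bool" where
  "block_move \<sigma> \<mu> a b u F w \<longleftrightarrow> a < b \<and> F \<noteq> [] \<and> hd F = a \<and> last F = a \<and> a \<notin> set u \<and> a \<notin> set w \<and>
     \<sigma> = u @ F @ [b] @ w \<and> \<mu> = u @ [b] @ F @ w"

lemma avoiding_decompD:
  assumes "avoiding (u @ a # v @ b # w @ a # t)"
  shows "b \<le> a"
proof -
  let ?s = "u @ a # v @ b # w @ a # t"
  define L where "L = labels ?s"
  have "map fst L = ?s" unfolding L_def by (rule map_fst_labels_from)
  then obtain U i V j W k T where "L = U @ (a, i) # V @ (b, j) # W @ (a, k) # T"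
    by (auto simp: map_eq_append_conv append_eq_map_conv map_eq_Cons_conv Cons_eq_map_conv)
  then show ?thesis unfolding L_def using avoidingD[OF assms, of "(a, i)" "(b, j)" "(a, k)"] by simp
qed

lemma avoiding_between:
  assumes "avoiding (u @ F @ w)" "F \<noteq> []" "hd F = a" "last F = a" "x \<in> set F"
  shows "x \<le> a"
proof (cases "x = a")
  case False
  obtain F1 where "F = a # F1" using assms(2,3) by (cases F) auto
  moreover from this have "F1 \<noteq> []" "last F1 = a" using False assms(4,5) by (auto split: if_splits)
  moreover from this obtain F2 where "F1 = F2 @ [a]" by (metis append_butlast_last_id)
  ultimately have F: "F = a # F2 @ [a]" by simp
  then have "x \<in> set F2" using False assms(5) by auto
  then obtain v v' where "F2 = v @ x # v'" by (meson split_list)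
  then show ?thesis using avoiding_decompD[of u a v x v' w] assms(1) F by simp
qed simp

text \<open>By avoidance all letters of the block are at most \<open>a < b\<close>, so
  \<open>labels_move\<close> applies. The length of \<open>W\<close> is recorded to locate the block
  in other decompositions of the same word.\<close>

lemma block_move_labels:
  assumes "avoiding \<sigma>" "block_move \<sigma> \<mu> a b u F w"
  obtains U G y W where "labels \<sigma> = U @ G @ [y] @ W" "labels \<mu> = U @ [y] @ G @ W" "fst y = b"
    "G \<noteq> []" "fst (hd G) = a" "fst (last G) = a" "\<forall>x\<in>set G. fst x \<le> a"
    "\<forall>x\<in>set U. fst x \<noteq> a" "length W = length w"
proof -
  note m = assms(2)[unfolded block_move_def]
  have F: "x \<le> a" if "x \<in> set F" for x
    using avoiding_between[of u F "[b] @ w" a x] assms(1) m that by auto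
  then have "b \<notin> set F" using m leD by blast
  from labels_move[OF this, of u w] obtain U G y W where
    l: "labels (u @ F @ [b] @ w) = U @ G @ [y] @ W" "labels (u @ [b] @ F @ w) = U @ [y] @ G @ W"
      "map fst U = u" "map fst G = F" "fst y = b" "map fst W = w" .
  have "G \<noteq> []" using m l(4) by auto
  moreover from this have "fst (hd G) = a" "fst (last G) = a"
    using m l(4) by (auto simp: hd_map last_map)
  moreover have "fst x \<le> a" if "x \<in> set G" for x using F l(4) that by auto
  moreover have "fst x \<noteq> a" if "x \<in> set U" for x using m l(3) that by force
  moreover have "length W = length w" using l(6) by auto
  ultimately show ?thesis using that[of U G y W] l m by auto
qed

lemma hd_precedes: "x \<in> set xs \<Longrightarrow> x \<noteq> hd xs \<Longrightarrow> precedes xs (hd xs) x"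
  by (cases xs) auto

text \<open>Only pairs of \<open>y\<close> with a block entry are new. A pattern beginning with such
  a pair would need a block letter above \<open>b\<close>. If \<open>p\<close>, \<open>y\<close>,
  \<open>r\<close> is a pattern with \<open>r\<close> in the block, then \<open>p\<close> lies in
  \<open>U\<close>, so its letter is not \<open>a\<close>; thus \<open>r\<close> is smaller than
  \<open>a\<close>, and \<open>p\<close>, \<open>hd G\<close>, \<open>r\<close> was already a
  pattern in \<open>\<sigma>\<close>.\<close>

lemma block_move_avoiding:
  assumes "avoiding \<sigma>" "block_move \<sigma> \<mu> a b u F w"
  shows "avoiding \<mu>"
proof -
  obtain U G y W where l: "labels \<sigma> = U @ G @ [y] @ W" "labels \<mu> = U @ [y] @ G @ W" "fst y = b"
      "G \<noteq> []" "fst (hd G) = a" "fst (last G) = a" "\<forall>x\<in>set G. fst x \<le> a"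
      "\<forall>x\<in>set U. fst x \<noteq> a" "length W = length w"
    using block_move_labels[OF assms] .
  have "a < b" using assms(2) by (simp add: block_move_def)
  have dist: "distinct (U @ G @ [y] @ W)" using distinct_labels_from l(1) by metis
  have prec: "precedes (labels \<mu>) p q \<longleftrightarrow>
      precedes (labels \<sigma>) p q \<and> \<not> (p \<in> set G \<and> q = y) \<or> p = y \<and> q \<in> set G" for p q
    unfolding l(1,2) by (rule precedes_move[OF dist])
  have "fst q \<le> fst p"
    if p: "precedes (labels \<mu>) p q" and q: "precedes (labels \<mu>) q r"
      and pr: "fst p = fst r" for p q r
  proof (cases "p = y \<and> q \<in> set G")
    case True
    then show ?thesis using l(3,7) \<open>a < b\<close> by fastforce
  next
    case False
    then have p': "precedes (labels \<sigma>) p q" "\<not> (p \<in> set G \<and> q = y)" using p prec by auto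
    show ?thesis
    proof (cases "q = y \<and> r \<in> set G")
      case True
      then have pU: "p \<in> set U"
        using p' l(1) dist by (auto dest: precedes_in_set)
      then have "fst r \<noteq> a" using l(8) pr by metis
      then have "fst r < a" "r \<noteq> hd G" using True l(5,7) by (auto simp: le_less)
      moreover have "precedes (labels \<sigma>) p (hd G)" using pU l(1,4) by auto
      moreover have "precedes (labels \<sigma>) (hd G) r"
        using hd_precedes[of r G] True \<open>r \<noteq> hd G\<close> l(1) by auto
      ultimately have False using avoidingD[OF assms(1)] pr l(5) by (metis leD)
      then show ?thesis ..
    next
      case False
      then have "precedes (labels \<sigma>) q r" using q prec by auto
      then show ?thesis using avoidingD[OF assms(1) p'(1)] pr by blast
    qed
  qed
  then show ?thesis unfolding avoiding_def by blast
qed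

text \<open>Reversing the ascent at the end of the block forces the whole move. In
  \<open>\<tau>\<close>, \<open>y\<close> precedes every \<open>a\<close> of the block, since an
  \<open>a\<close> before \<open>y\<close> would form a pattern with the last one. A smaller block
  letter follows \<open>hd G\<close> by a co-inversion of \<open>\<sigma>\<close>, hence also in
  \<open>\<tau>\<close>, and so follows \<open>y\<close>.\<close>

lemma block_move_least:
  assumes "avoiding \<tau>" "mset \<sigma> = mset \<tau>" "coinv \<sigma> \<subseteq> coinv \<tau>"
    and l: "labels \<sigma> = U @ G @ [y] @ W" "labels \<mu> = U @ [y] @ G @ W"
    and G: "G \<noteq> []" "fst (hd G) = a" "fst (last G) = a" "\<forall>x\<in>set G. fst x \<le> a"
    and "a < fst y" "(last G, y) \<in> coinv \<tau>"
  shows "coinv \<mu> \<subseteq> coinv \<tau>"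
proof -
  have set: "set (labels \<tau>) = set (U @ G @ [y] @ W)"
    using set_labels_mset_eq[OF assms(2)] l(1) by simp
  have "distinct (U @ G @ [y] @ W)" using distinct_labels_from l(1) by metis
  then have y: "y \<notin> set G" by auto
  have last: "precedes (labels \<tau>) y (last G)" using assms(11) by (simp add: coinv_eq)
  have a: "precedes (labels \<tau>) y x" if "x \<in> set G" "fst x = a" for x
  proof (rule ccontr)
    assume "\<not> precedes (labels \<tau>) y x"
    then have "precedes (labels \<tau>) x y"
      using precedes_total[of x "labels \<tau>" y] set that y by auto
    from avoidingD[OF assms(1) this last] that G(3) assms(10) show False by simp
  qed
  have "precedes (labels \<tau>) y x" if x: "x \<in> set G" for x
  proof (cases "fst x = a")
    case False
    then have "precedes (labels \<sigma>) (hd G) x"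
      using hd_precedes[OF x] G(2) l(1) by auto
    then have "(x, hd G) \<in> coinv \<sigma>"
      using False G(2) bspec[OF G(4) x] by (simp add: coinv_eq le_less)
    then have "precedes (labels \<tau>) (hd G) x" using assms(3) by (auto simp: coinv_eq)
    moreover have "precedes (labels \<tau>) y (hd G)" using a G by simp
    ultimately show ?thesis using precedes_trans distinct_labels_from by metis
  qed (use a x in simp)
  moreover have "fst x < fst y" if "x \<in> set G" for x using bspec[OF G(4) that] assms(10) by simp
  ultimately show ?thesis using coinv_move[OF l] assms(3) by (auto simp: coinv_eq)
qed

text \<open>An \<open>a\<close> to the right of the ascent would complete a pattern with it, so the
  ascent begins with the last \<open>a\<close>, and the block reaches back to the first one.\<close>

lemma ascent_imp_block_move:
  assumes "avoiding (u' @ [a] @ [b] @ w)" "a < b"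
  obtains u F where "block_move (u' @ [a] @ [b] @ w) (u @ [b] @ F @ w) a b u F w" "u' @ [a] = u @ F"
proof -
  have w: "a \<notin> set w"
  proof
    assume "a \<in> set w"
    then obtain w1 w2 where "w = w1 @ a # w2" by (meson split_list)
    then show False using avoiding_decompD[of u' a "[]" b w1 w2] assms by simp
  qed
  \<comment> \<open>The search includes the \<open>a\<close> of the ascent itself, which is the
    first one if \<open>u'\<close> contains none.\<close>
  obtain u F where F: "u' @ [a] = u @ a # F" "a \<notin> set u"
    using split_list_first[of a "u' @ [a]"] by auto
  have "u' @ [a] @ [b] @ w = (u' @ [a]) @ [b] @ w" by simp
  also have "\<dots> = u @ (a # F) @ [b] @ w" unfolding F(1) by simp
  finally have "u' @ [a] @ [b] @ w = u @ (a # F) @ [b] @ w" .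
  moreover have "last (a # F) = a"
    using arg_cong[OF F(1), of last] by (simp split: if_splits)
  ultimately have "block_move (u' @ [a] @ [b] @ w) (u @ [b] @ (a # F) @ w) a b u (a # F) w"
    using w F(2) assms(2) by (simp add: block_move_def)
  then show ?thesis using that F(1) by blast
qed

section \<open>Block moves and the congruence\<close>

text \<open>The letter \<open>b\<close> passes \<open>F\<close> from right to left, and
  \<open>v\<close> collects the letters passed. The \<open>a\<close> kept on the right is the
  witness: an \<open>a\<close> is passed by the first rule, a smaller letter by the second, enclosed
  by the leading \<open>a\<close> of \<open>F\<close> and the right one.\<close>

lemma cong_slide:
  assumes "a < b"
  shows "u @ F @ [b] @ v @ [a] @ w \<in> mperms m n \<Longrightarrow> (\<And>x. x \<in> set F \<Longrightarrow> x \<le> a) \<Longrightarrow>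
    (F \<noteq> [] \<Longrightarrow> hd F = a) \<Longrightarrow>
    metasylvester_cong m n (u @ F @ [b] @ v @ [a] @ w) (u @ [b] @ F @ v @ [a] @ w)"
proof (induction F arbitrary: v rule: rev_induct)
  case Nil
  show ?case by (simp add: metasylvester_cong_refl)
next
  case (snoc x F)
  let ?s = "u @ (F @ [x]) @ [b] @ v @ [a] @ w"
  let ?t = "u @ F @ [b] @ (x # v) @ [a] @ w"
  have step: "metasylvester_step ?s ?t"
  proof (cases "x = a")
    case True
    then show ?thesis using metasylvester_step.intros(1)[OF assms, of "u @ F" v w] by simp
  next
    case False
    then have x: "x < a" using snoc.prems(2)[of x] by (simp add: le_less)
    obtain F' where "F = a # F'" using snoc.prems(3) False by (cases F) auto
    then show ?thesis
      using metasylvester_step.intros(2)[OF x assms, of u F' v w] by simp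
  qed
  have "?t \<in> mperms m n" by (rule mperms_cong_mset[OF snoc.prems(1)]) simp
  then have "metasylvester_cong m n ?t (u @ [b] @ F @ (x # v) @ [a] @ w)"
    using snoc.prems(2,3) by (intro snoc.IH) (auto simp: hd_append split: if_splits)
  from metasylvester_cong_trans[OF metasylvester_cong_step[OF snoc.prems(1) step] this]
  show ?case by simp
qed

text \<open>After the exchange of the ascent, the last \<open>a\<close> stands to the right of
  \<open>b\<close> and is the witness that \<open>cong_slide\<close> needs, with \<open>v\<close>
  empty at the start.\<close>

lemma block_move_cong:
  assumes "avoiding \<sigma>" "\<sigma> \<in> mperms m n" "block_move \<sigma> \<mu> a b u (F @ [a]) w"
  shows "metasylvester_cong m n (u @ F @ [b] @ [a] @ w) \<mu>"
proof -
  note m = assms(3)[unfolded block_move_def]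
  have "u @ F @ [b] @ [a] @ w \<in> mperms m n"
    using m by (intro mperms_cong_mset[OF assms(2)]) simp
  moreover have "x \<le> a" if "x \<in> set F" for x
    using avoiding_between[of u "F @ [a]" "[b] @ w" a x] assms(1) m that by auto
  moreover have "F \<noteq> [] \<Longrightarrow> hd F = a" using m by (auto simp: hd_append)
  ultimately show ?thesis using cong_slide[of a b u F "[]" w m n] m by simp
qed

section \<open>Covers in the metasylvester lattice\<close>

lemma mset_block_move: "block_move \<sigma> \<mu> a b u F w \<Longrightarrow> mset \<mu> = mset \<sigma>"
  by (simp add: block_move_def)

lemma block_move_less:
  assumes "avoiding \<sigma>" "block_move \<sigma> \<mu> a b u F w"
  shows "mperm_less \<sigma> \<mu>"
proof -
  obtain U G y W where l: "labels \<sigma> = U @ G @ [y] @ W" "labels \<mu> = U @ [y] @ G @ W" "fst y = b"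
      "G \<noteq> []" "fst (hd G) = a" "fst (last G) = a" "\<forall>x\<in>set G. fst x \<le> a"
      "\<forall>x\<in>set U. fst x \<noteq> a" "length W = length w"
    using block_move_labels[OF assms] .
  have ab: "a < b" using assms(2) by (simp add: block_move_def)
  have lt: "fst x < fst y" if "x \<in> set G" for x using l(3) bspec[OF l(7) that] ab by simp
  have "hd G \<noteq> y" using lt[of "hd G"] l(4) by auto
  then have "\<sigma> \<noteq> \<mu>" using l(1,2,4) by (cases G) auto
  then show ?thesis using coinv_move[OF l(1,2) lt] by (auto simp: mperm_less_def mperm_le_def)
qed

text \<open>Both inclusions rest on \<open>block_move_least\<close>. A larger avoiding word reverses
  some ascent of \<open>\<sigma>\<close>, hence lies above its block move. A word strictly between
  \<open>\<sigma>\<close> and \<open>\<mu>\<close> reverses an ascent too, which can only be the one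
  at the end of the block, so it already lies above \<open>\<mu>\<close>.\<close>

lemma successors_Max_mperms:
  assumes "\<sigma> \<in> Max_mperms m n"
  shows "successors (Max_mperms m n) \<sigma> = {\<mu>. \<exists>a b u F w. block_move \<sigma> \<mu> a b u F w}"
proof (intro set_eqI iffI)
  have s: "\<sigma> \<in> mperms m n" "avoiding \<sigma>" using assms by (auto simp: Max_mperms_eq)
  {
    fix \<tau> assume "\<tau> \<in> successors (Max_mperms m n) \<sigma>"
    then have t: "\<tau> \<in> mperms m n" "avoiding \<tau>" "coinv \<sigma> \<subseteq> coinv \<tau>" "\<sigma> \<noteq> \<tau>"
      "\<And>z. z \<in> Max_mperms m n \<Longrightarrow> mperm_less \<sigma> z \<Longrightarrow> \<not> mperm_less z \<tau>"
      by (auto simp: successors_def mperm_less_def mperm_le_def Max_mperms_eq)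
    have mset: "mset \<sigma> = mset \<tau>" using mset_mperms[OF s(1) t(1)] .
    obtain A x y B where l: "labels \<sigma> = A @ x # y # B" "fst x < fst y" "(x, y) \<in> coinv \<tau>"
      using coinv_subset_imp_ascent[OF mset t(3,4)] .
    have "map fst (labels \<sigma>) = map fst A @ [fst x] @ [fst y] @ map fst B" unfolding l(1) by simp
    then have eq: "\<sigma> = map fst A @ [fst x] @ [fst y] @ map fst B" by simp
    obtain u F where m: "block_move \<sigma> (u @ [fst y] @ F @ map fst B) (fst x) (fst y) u F (map fst B)"
      using ascent_imp_block_move[of "map fst A" "fst x" "fst y" "map fst B"] s(2) l(2)
      unfolding eq[symmetric] by blast
    let ?\<mu> = "u @ [fst y] @ F @ map fst B"
    obtain U G y' W where l': "labels \<sigma> = U @ G @ [y'] @ W" "labels ?\<mu> = U @ [y'] @ G @ W"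
        "fst y' = fst y" "G \<noteq> []" "fst (hd G) = fst x" "fst (last G) = fst x"
        "\<forall>z\<in>set G. fst z \<le> fst x"
        "\<forall>z\<in>set U. fst z \<noteq> fst x" "length W = length (map fst B)"
      using block_move_labels[OF s(2) m] .
    \<comment> \<open>Two decompositions of \<open>labels \<sigma>\<close>, by the ascent and by the
      block; their tails have equal length, so the ascent is the last block entry followed by the
      moved one.\<close>
    have "A @ x # y # B = (U @ butlast G) @ last G # y' # W"
      using l(1) l'(1) append_butlast_last_id[OF l'(4)]
      by (metis append.assoc append_Cons append_Nil)
    then have "x = last G" "y = y'"
      using l'(9) append_eq_append_conv[of A "U @ butlast G" "x # y # B" "last G # y' # W"]
      by simp_all
    then have "coinv ?\<mu> \<subseteq> coinv \<tau>"
      using block_move_least[OF t(2) mset t(3) l'(1,2,4,5,6,7)] l(2,3) by simp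
    moreover have "?\<mu> \<in> Max_mperms m n"
      using block_move_avoiding[OF s(2) m] mperms_cong_mset[OF s(1) mset_block_move[OF m]]
      by (simp add: Max_mperms_eq)
    ultimately have "?\<mu> = \<tau>" using t(5) block_move_less[OF s(2) m]
      by (auto simp: mperm_less_def mperm_le_def)
    then show "\<tau> \<in> {\<mu>. \<exists>a b u F w. block_move \<sigma> \<mu> a b u F w}" using m by blast
  next
    fix \<mu> assume "\<mu> \<in> {\<mu>. \<exists>a b u F w. block_move \<sigma> \<mu> a b u F w}"
    then obtain a b u F w where m: "block_move \<sigma> \<mu> a b u F w" by blast
    obtain U G y W where l: "labels \<sigma> = U @ G @ [y] @ W" "labels \<mu> = U @ [y] @ G @ W" "fst y = b"
        "G \<noteq> []" "fst (hd G) = a" "fst (last G) = a" "\<forall>x\<in>set G. fst x \<le> a"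
        "\<forall>x\<in>set U. fst x \<noteq> a" "length W = length w"
      using block_move_labels[OF s(2) m] .
    have ab: "a < fst y" using m l(3) by (simp add: block_move_def)
    have c: "coinv \<mu> = coinv \<sigma> \<union> set G \<times> {y}"
      using coinv_move[OF l(1,2)] l(7) ab by fastforce
    have mem: "\<mu> \<in> Max_mperms m n"
      using block_move_avoiding[OF s(2) m] mperms_cong_mset[OF s(1) mset_block_move[OF m]]
      by (simp add: Max_mperms_eq)
    have "\<not> (mperm_less \<sigma> z \<and> mperm_less z \<mu>)" if "z \<in> Max_mperms m n" for z
    proof
      assume less: "mperm_less \<sigma> z \<and> mperm_less z \<mu>"
      have z: "z \<in> mperms m n" "avoiding z" using that by (auto simp: Max_mperms_eq)
      have z': "coinv \<sigma> \<subseteq> coinv z" "\<sigma> \<noteq> z" "coinv z \<subseteq> coinv \<mu>" "z \<noteq> \<mu>"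
        using less by (auto simp: mperm_less_def mperm_le_def)
      have mset: "mset \<sigma> = mset z" using mset_mperms[OF s(1) z(1)] .
      obtain A x y' B where l': "labels \<sigma> = A @ x # y' # B" "(x, y') \<in> coinv z"
        using coinv_subset_imp_ascent[OF mset z'(1,2)] .
      have "precedes (labels \<sigma>) x y'" using l'(1) by simp
      then have "(x, y') \<notin> coinv \<sigma>"
        using precedes_asym[of "labels \<sigma>" x y'] by (simp add: coinv_eq)
      \<comment> \<open>The co-inversions of \<open>z\<close> missing in \<open>\<sigma>\<close> are
        among those added by the move, and all of these have larger part \<open>y\<close>.\<close>
      then have y': "y' = y" using l'(2) z'(3) c by auto
      \<comment> \<open>Labels are distinct, so \<open>y\<close> occurs once and its left neighbour
        \<open>x\<close> must be the last entry of the block.\<close>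
      have eq: "(A @ [x]) @ y # B = (U @ G) @ y # W" using l(1) l'(1) y' by simp
      have dist: "distinct (labels \<sigma>)" by simp
      have "y \<notin> set (A @ [x])" "y \<notin> set B" using dist unfolding l'(1) y' by auto
      from append_Cons_eq_iff[OF this] have "A @ [x] = U @ G" using eq by blast
      from arg_cong[OF this, of last] have "x = last G" using l(4) by simp
      then have "coinv \<mu> \<subseteq> coinv z"
        using block_move_least[OF z(2) mset z'(1) l(1,2,4,5,6,7) ab] l'(2) y' by simp
      then have "coinv z = coinv \<mu>" using z'(3) by simp
      moreover have "mset z = mset \<mu>" using mset_block_move[OF m] mset by simp
      ultimately show False using coinv_inject z'(4) by blast
    qed
    then show "\<mu> \<in> successors (Max_mperms m n) \<sigma>"
      using mem block_move_less[OF s(2) m] by (auto simp: successors_def)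
  }
qed

section \<open>Explicit form of the covers and comparison of the two lattices\<close>

text \<open>The two ends of \<open>F\<close> coincide or are different occurrences of
  \<open>a\<close>; the number \<open>m\<close> of occurrences decides which.\<close>

lemma count_list_block:
  assumes "count_list F a = m" "m \<ge> 1" "F \<noteq> []" "hd F = a" "last F = a"
  obtains v where "F = (if m = 1 then [a] else [a] @ v @ [a])"
proof -
  obtain F1 where F1: "F = a # F1" using assms(3,4) by (cases F) auto
  show ?thesis
  proof (cases F1 rule: rev_cases)
    case Nil
    then show ?thesis using that F1 assms(1) by simp
  next
    case (snoc v c)
    then have "F = [a] @ v @ [a]" using F1 assms(5) by simp
    moreover from this have "m \<noteq> 1" using assms(1) by auto
    ultimately show ?thesis using that by simp
  qed
qed

lemma block_move_iff:
  assumes "\<sigma> \<in> mperms m n" "m \<ge> 1"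
  shows "(\<exists>a b u F w. block_move \<sigma> \<mu> a b u F w) \<longleftrightarrow>
    \<mu> \<in> mperms m n \<and> (\<exists>a b u v w F. a < b \<and> F = (if m = 1 then [a] else [a] @ v @ [a]) \<and>
      a \<notin> set u \<and> a \<notin> set w \<and> \<sigma> = u @ F @ [b] @ w \<and> \<mu> = u @ [b] @ F @ w)" (is "?L \<longleftrightarrow> ?R")
proof
  assume ?L
  then obtain a b u F w where m: "block_move \<sigma> \<mu> a b u F w" by blast
  note m' = m[unfolded block_move_def]
  have "a \<in> set \<sigma>" using m' by (metis Un_iff last_in_set set_append)
  \<comment> \<open>All occurrences of \<open>a\<close> lie in \<open>F\<close>, as \<open>u\<close>
    and \<open>w\<close> contain none and \<open>b\<close> is larger.\<close>
  from count_list_mperms[OF assms(1) this] have "count_list F a = m"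
    using m' by (auto simp: count_list_0_iff)
  then obtain v where "F = (if m = 1 then [a] else [a] @ v @ [a])"
    using count_list_block[of F a m] assms(2) m' by metis
  moreover have "\<mu> \<in> mperms m n" using mperms_cong_mset[OF assms(1) mset_block_move[OF m]] .
  ultimately show ?R using m' by blast
next
  assume ?R
  then obtain a b u v w F where "a < b" "F = (if m = 1 then [a] else [a] @ v @ [a])"
      "a \<notin> set u" "a \<notin> set w" "\<sigma> = u @ F @ [b] @ w" "\<mu> = u @ [b] @ F @ w" by blast
  then have "block_move \<sigma> \<mu> a b u F w" by (auto simp: block_move_def)
  then show ?L by blast
qed

text \<open>The exchange of an ascent is congruent to the corresponding block move, which avoids the
  pattern and is therefore the maximum of the class. Conversely, every block move arises from the
  ascent formed by its last \<open>a\<close> and \<open>b\<close>.\<close>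

lemma MaxClass_successors:
  assumes "\<sigma> \<in> mperms m n" "avoiding \<sigma>"
  shows "{\<mu>. \<exists>\<sigma>'. \<sigma>' \<in> successors (mperms m n) \<sigma> \<and> \<mu> = MaxClass m n \<sigma>'} =
    {\<mu>. \<exists>a b u F w. block_move \<sigma> \<mu> a b u F w}"
proof -
  have main: "MaxClass m n (u @ F @ [b] @ [a] @ w) = \<mu>"
    if m: "block_move \<sigma> \<mu> a b u (F @ [a]) w" for \<mu> a b u F w
    using block_move_cong[OF assms(2,1) m] block_move_avoiding[OF assms(2) m]
      mperms_cong_mset[OF assms(1) mset_block_move[OF m]] by (intro MaxClass_eq)
  show ?thesis
  proof (intro set_eqI iffI)
    fix \<mu> assume "\<mu> \<in> {\<mu>. \<exists>\<sigma>'. \<sigma>' \<in> successors (mperms m n) \<sigma> \<and> \<mu> = MaxClass m n \<sigma>'}"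
    then obtain u' a b w where s: "a < b" "\<sigma> = u' @ [a] @ [b] @ w"
        "\<mu> = MaxClass m n (u' @ [b] @ [a] @ w)"
      unfolding successors_mperms[OF assms(1)] by blast
    obtain u F where m: "block_move \<sigma> (u @ [b] @ F @ w) a b u F w" "u' @ [a] = u @ F"
      using ascent_imp_block_move[of u' a b w] assms(2) s(1,2) by metis
    obtain F' where F: "F = F' @ [a]"
      using m(1) unfolding block_move_def by (metis append_butlast_last_id)
    then have "u' = u @ F'" using m(2) by simp
    then have "\<mu> = u @ [b] @ F @ w" using main m(1) s(3) F by simp
    then show "\<mu> \<in> {\<mu>. \<exists>a b u F w. block_move \<sigma> \<mu> a b u F w}" using m(1) by blast
  next
    fix \<mu> assume "\<mu> \<in> {\<mu>. \<exists>a b u F w. block_move \<sigma> \<mu> a b u F w}"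
    then obtain a b u F w where m: "block_move \<sigma> \<mu> a b u F w" by blast
    obtain F' where F: "F = F' @ [a]"
      using m unfolding block_move_def by (metis append_butlast_last_id)
    then have "\<sigma> = (u @ F') @ [a] @ [b] @ w" "a < b" using m by (auto simp: block_move_def)
    then have "(u @ F') @ [b] @ [a] @ w \<in> successors (mperms m n) \<sigma>"
      unfolding successors_mperms[OF assms(1)] by blast
    moreover have "\<mu> = MaxClass m n ((u @ F') @ [b] @ [a] @ w)" using main m F by simp
    ultimately show "\<mu> \<in> {\<mu>. \<exists>\<sigma>'. \<sigma>' \<in> successors (mperms m n) \<sigma> \<and> \<mu> = MaxClass m n \<sigma>'}" by blast
  qed
qed

theorem proposition3p6:
  fixes m n :: nat and \<sigma> :: "nat list"
  assumes "m \<ge> 1" and "n \<ge> 1"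
    and "\<sigma> \<in> Max_mperms m n"
  shows "successors (Max_mperms m n) \<sigma> =
           {\<mu>. \<exists>\<sigma>'. \<sigma>' \<in> successors (mperms m n) \<sigma> \<and> \<mu> = MaxClass m n \<sigma>'}
       \<and> successors (Max_mperms m n) \<sigma> =
           {\<mu> \<in> mperms m n. \<exists>a b u v w F. a < b
              \<and> F = (if m = 1 then [a] else [a] @ v @ [a])
              \<and> a \<notin> set u \<and> a \<notin> set w
              \<and> \<sigma> = u @ F @ [b] @ w
              \<and> \<mu> = u @ [b] @ F @ w}"
proof -
  have s: "\<sigma> \<in> mperms m n" "avoiding \<sigma>" using assms(3) by (auto simp: Max_mperms_eq)
  show ?thesis
    unfolding successors_Max_mperms[OF assms(3)] MaxClass_successors[OF s]
      block_move_iff[OF s(1) assms(1)]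
    by simp
qed

end
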